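(* Let $(A,B,p,r,c)$ be an LPP situation with producer set $N$ and let $(N,v^{opt})$ be the optimistic LPP game associated with it, $v^{opt}(S)=\mathrm{value}(S;\min\{d_S,r\})$ for nonempty $S\subseteq N$ and $v^{opt}(\varnothing)=0$. If $d_N\le r$, then $C(v^{opt})\neq\varnothing$.
   Context: LPP situation (linear production situation with a common-pool resource). $N=\{1,\dots,n\}$ is a set of producers, $G=\{1,\dots,g\}$ a set of goods, $Q=\{1,\dots,q\}$ a set of resources; in addition there is one external common-pool resource, of which a total amount $r\ge 0$ is available at unit cost $c\ge 0$. Producer $i$ owns $b^i\in\mathbb{R}_+^q$; $b^S=\sum_{i\in S}b^i$; $B$ is the $q\times n$ matrix with columns $b^i$, and for every $t\in Q$ there is a producer $i$ with $b^i_t>0$. $A$ is a nonnegative $(q+1)\times g$ matrix ($a_{tj}$ is the amount of resource $t$ needed per unit of good $j$; row $q+1$ refers to the common-pool resource), with $a_{(q+1)j}>0$ for all $j\in G$ and, for every $j\in G$, some $t\in Q$ with $a_{tj}>0$. $p\in\mathbb{R}_{++}^g$ is the price vector and $p_j>a_{(q+1)j}c$ for all $j\in G$. For a coalition $S\subseteq N$ and $z\ge 0$, $$\mathrm{value}(S;z)=\max\Big\{\sum_{j=1}^g p_jx_j-cz \;:\; Ax\le \begin{pmatrix} b^S\\ z\end{pmatrix},\ x\in\mathbb{R}^g_+\Big\}.$$ The optimal demand of $S$ is $d_S=\min\{z\ge 0:\ \mathrm{value}(S;z)=\max_{z'\ge 0}\mathrm{value}(S;z')\}$. It is assumed that for every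 nonempty $S$ there is $z$ with $\mathrm{value}(S;z)>0$ (so $d_S>0$). The core of a game $(N,v)$ is $C(v)=\{x\in\mathbb{R}^N: \sum_{i\in N}x_i=v(N),\ \sum_{i\in S}x_i\ge v(S)\ \forall S\subseteq N\}$. *)

theory Defs
  imports "HOL-Analysis.Analysis"
begin

text \<open>
  Producers, goods and privately owned resources are the elements of the finite types \<open>'n\<close>, \<open>'g\<close>
  and \<open>'q\<close>. The rows of the \<open>(q+1) \<times> g\<close> matrix \<open>A\<close> are indexed by \<open>'q option\<close>: row \<open>Some t\<close> belongs
  to resource \<open>t\<close> and row \<open>None\<close>, the last one, to the common-pool resource. Column \<open>i\<close> of \<open>B\<close> is the
  resource bundle of producer \<open>i\<close>. The order on vectors is componentwise.
\<close>

definition coalition_resources :: "real^'n^'q \<Rightarrow> 'n::finite set \<Rightarrow> real^'q" where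
  "coalition_resources B S = (\<Sum>i\<in>S. column i B)"

definition append_pool :: "real^'q \<Rightarrow> real \<Rightarrow> real^('q::finite option)" where
  "append_pool b z = (\<chi> k. case k of Some t \<Rightarrow> b $ t | None \<Rightarrow> z)"

definition feasible_plans ::
  "real^'g^('q::finite option) \<Rightarrow> real^'n^'q \<Rightarrow> 'n::finite set \<Rightarrow> real \<Rightarrow> (real^'g::finite) set" where
  "feasible_plans A B S z = {x. 0 \<le> x \<and> A *v x \<le> append_pool (coalition_resources B S) z}"

text \<open>
  \<open>GREATEST\<close> and \<open>LEAST\<close> below are attained maxima and minima, not suprema and infima. They are only
  meaningful for an LPP situation and, in \<open>coalition_value\<close>, for \<open>z \<ge> 0\<close>.
\<close>

definition coalition_value ::
  "real^'g^('q::finite option) \<Rightarrow> real^'n^'q \<Rightarrow> real^'g \<Rightarrow> real \<Rightarrow>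
   'n::finite set \<Rightarrow> real \<Rightarrow> real" where
  "coalition_value A B p c S z =
     (GREATEST v. v \<in> {(\<Sum>j\<in>UNIV. p $ j * x $ j) - c * z | x. x \<in> feasible_plans A B S z})"

definition optimal_demand ::
  "real^'g^('q::finite option) \<Rightarrow> real^'n^'q \<Rightarrow> real^'g \<Rightarrow> real \<Rightarrow> 'n::finite set \<Rightarrow> real" where
  "optimal_demand A B p c S =
     (LEAST z. 0 \<le> z \<and>
        coalition_value A B p c S z = (GREATEST v. v \<in> coalition_value A B p c S ` {0..}))"

definition lpp_situation ::
  "real^'g^('q::finite option) \<Rightarrow> real^'n::finite^'q \<Rightarrow> real^'g \<Rightarrow> real \<Rightarrow> real \<Rightarrow> bool" where
  "lpp_situation A B p r c \<longleftrightarrow>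
     (\<forall>k j. 0 \<le> A $ k $ j) \<and>
     (\<forall>j. 0 < A $ None $ j) \<and>
     (\<forall>j. \<exists>t. 0 < A $ Some t $ j) \<and>
     (\<forall>t i. 0 \<le> B $ t $ i) \<and>
     (\<forall>t. \<exists>i. 0 < B $ t $ i) \<and>
     0 \<le> r \<and> 0 \<le> c \<and>
     (\<forall>j. 0 < p $ j) \<and>
     (\<forall>j. A $ None $ j * c < p $ j) \<and>
     (\<forall>S. S \<noteq> {} \<longrightarrow> (\<exists>z\<ge>0. 0 < coalition_value A B p c S z))"

definition optimistic_game ::
  "real^'g^('q::finite option) \<Rightarrow> real^'n^'q \<Rightarrow> real^'g \<Rightarrow> real \<Rightarrow> real \<Rightarrow>
   'n::finite set \<Rightarrow> real" where
  "optimistic_game A B p r c S =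
     (if S = {} then 0 else coalition_value A B p c S (min (optimal_demand A B p c S) r))"

definition core :: "('n::finite set \<Rightarrow> real) \<Rightarrow> (real^'n) set" where
  "core v = {x. (\<Sum>i\<in>UNIV. x $ i) = v UNIV \<and> (\<forall>S. v S \<le> (\<Sum>i\<in>S. x $ i))}"

end

theory Submission
  imports Defs
begin

text \<open>
  When the pool is unrestricted, a coalition demands exactly what its plan uses, so its best value is
  that of the linear program with objective \<open>p - c a\<close> (\<open>a\<close> the pool row of \<open>A\<close>) over the plans
  feasible for its own resources. If \<open>d\<^sub>N \<le> r\<close>, the grand coalition attains this value, and no other
  coalition exceeds its own. Hence an optimal dual price vector \<open>y\<close> of the program of the grand
  coalition yields the core element \<open>(y \<bullet> b\<^sup>i)\<^sub>i\<close>, as in Owen's theorem. Since the resources of the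
  grand coalition are strictly positive, \<open>y\<close> exists by Slater's condition and a separating hyperplane.
\<close>

section \<open>Nonnegative vectors and sign arguments\<close>

definition production_set :: "real^'g^'q \<Rightarrow> real^'q \<Rightarrow> (real^'g::finite) set" where
  "production_set M b = {x. 0 \<le> x \<and> M *v x \<le> b}"

lemma inner_nonneg_vec:
  fixes x y :: "real^'n"
  assumes "0 \<le> x" "0 \<le> y"
  shows "0 \<le> x \<bullet> y"
  using assms by (auto simp: inner_vec_def less_eq_vec_def intro!: sum_nonneg)

lemma inner_mono_vec:
  fixes x y z :: "real^'n"
  assumes "0 \<le> x" "y \<le> z"
  shows "x \<bullet> y \<le> x \<bullet> z"
  using inner_nonneg_vec[of x "z - y"] assms by (simp add: inner_diff_right)

text \<open>Turns a bound along a whole ray into a sign. It yields the signs of the multipliers and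
  the dual constraints in the duality proof.\<close>

lemma linear_bounded_above_imp_nonpos:
  fixes a d :: real
  assumes "\<And>t. 0 \<le> t \<Longrightarrow> a * t \<le> d"
  shows "a \<le> 0"
proof (rule ccontr)
  assume "\<not> a \<le> 0"
  then have "\<bar>d\<bar> + 1 \<le> d"
    using assms[of "(\<bar>d\<bar> + 1) / a"] by simp
  then show False by linarith
qed

section \<open>Duality and compactness for linear programs\<close>

lemma nonneg_orthant_convex: "convex {x::real^'n. 0 \<le> x}"
  by (auto simp: convex_def less_eq_vec_def)

text \<open>Strict positivity of \<open>b\<close> makes the zero plan a Slater point.
  \<open>V\<close> stands for any upper bound of the objective, hence an inequality rather than
  equality of optima.\<close>

lemma lp_dual_slater:
  fixes M :: "real^'g::finite^'q::finite" and b :: "real^'q" and w :: "real^'g" and V :: real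
  assumes b: "\<And>t. 0 < b $ t"
    and V: "\<And>x. x \<in> production_set M b \<Longrightarrow> w \<bullet> x \<le> V"
  obtains y where "0 \<le> y" "w \<le> y v* M" "y \<bullet> b \<le> V"
proof -
  \<comment> \<open>\<open>F\<close> records the slack and the gain over \<open>V\<close> of each
    nonnegative \<open>x\<close>. A common point with the open positive orthant \<open>P\<close>
    would be a feasible plan worth more than \<open>V\<close>.\<close>
  define F where "F = (\<lambda>x. (b - M *v x, w \<bullet> x - V)) ` {x. 0 \<le> x}"
  define P where "P = {(u::real^'q, s::real). (\<forall>t. 0 < u $ t) \<and> 0 < s}"
  have "F = (\<lambda>z. (b, - V) + z) ` ((\<lambda>x. (- (M *v x), w \<bullet> x)) ` {x. 0 \<le> x})"
    unfolding F_def image_image by simp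
  moreover have "linear (\<lambda>x. (- (M *v x), w \<bullet> x))"
    by (rule linearI) (simp_all add: matrix_vector_right_distrib inner_add_right
        matrix_vector_mult_scaleR)
  ultimately have convF: "convex F"
    by (simp add: convex_linear_image nonneg_orthant_convex convex_translation_eq del: image_image)
  have "P = (\<Inter>t. {u. axis t 1 \<bullet> u > 0}) \<times> {0<..}"
    by (auto simp: P_def inner_axis')
  then have convP: "convex P"
    by (auto intro!: convex_Times convex_INT convex_halfspace_gt)
  have onesP: "((\<chi> t. e), e) \<in> P" if "0 < e" for e
    using that by (simp add: P_def)
  have disj: "F \<inter> P = {}"
  proof -
    have False if "0 \<le> x" "\<forall>t. 0 < (b - M *v x) $ t" "0 < w \<bullet> x - V" for x
      using V[of x] that by (auto simp: production_set_def less_eq_vec_def less_le)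
    then show ?thesis by (auto simp: F_def P_def)
  qed
  have "(b, - V) \<in> F"
    unfolding F_def by (rule image_eqI[of _ _ 0]) auto
  then have "F \<noteq> {}" "P \<noteq> {}" using onesP[of 1] by auto
  then obtain n d where n: "n \<noteq> 0" and nF: "\<forall>z\<in>F. n \<bullet> z \<le> d" and nP: "\<forall>z\<in>P. n \<bullet> z \<ge> d"
    using separating_hyperplane_sets[OF convF convP _ _ disj] by metis
  obtain y l where yl: "n = (y, l)" by (cases n)
  \<comment> \<open>The points of \<open>P\<close> with all coordinates equal to \<open>e\<close>
    tend to the origin. For \<open>0 < d\<close>, the \<open>e\<close> chosen below would give
    \<open>e * s < d\<close>.\<close>
  have d: "d \<le> 0"
  proof (rule ccontr)
    assume "\<not> d \<le> 0"
    define s where "s = n \<bullet> ((\<chi> t. 1), 1)"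
    have "e * s \<ge> d" if "0 < e" for e
    proof -
      have "((\<chi> t. e), e) = e *\<^sub>R ((\<chi> t. 1), 1)" by (simp add: vec_eq_iff)
      then show ?thesis using nP onesP[OF that] by (metis inner_scaleR_right s_def)
    qed
    from this[of "d / (2 * (\<bar>s\<bar> + 1))"] \<open>\<not> d \<le> 0\<close> have "d * s \<ge> d * (2 * (\<bar>s\<bar> + 1))"
      by (simp add: field_simps)
    with \<open>\<not> d \<le> 0\<close> show False by auto
  qed
  \<comment> \<open>\<open>n\<close> is bounded below on \<open>P\<close>, which contains a ray in
    every positive coordinate direction, so no component of \<open>n\<close> is negative.\<close>
  have y: "0 \<le> y $ t" for t
  proof -
    have "- (y $ t) * k \<le> n \<bullet> ((\<chi> t. 1), 1) - d" if "0 \<le> k" for k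
    proof -
      have "((\<chi> t. 1) + k *\<^sub>R axis t 1, 1) \<in> P"
        using that by (auto simp: P_def axis_def)
      then have "d \<le> n \<bullet> ((\<chi> t. 1) + k *\<^sub>R axis t 1, 1)" using nP by blast
      then show ?thesis by (simp add: yl inner_add_right inner_axis mult.commute)
    qed
    from linear_bounded_above_imp_nonpos[OF this] show ?thesis by simp
  qed
  have l: "0 \<le> l"
  proof -
    have "- l * k \<le> n \<bullet> ((\<chi> t. 1), 1) - d" if "0 \<le> k" for k
    proof -
      have "((\<chi> t. 1), 1 + k) \<in> P" using that by (auto simp: P_def)
      then have "d \<le> n \<bullet> ((\<chi> t. 1), 1 + k)" using nP by blast
      then show ?thesis by (simp add: yl algebra_simps)
    qed
    from linear_bounded_above_imp_nonpos[OF this] show ?thesis by simp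
  qed
  have key: "y \<bullet> (b - M *v x) + l * (w \<bullet> x - V) \<le> 0" if "0 \<le> x" for x
  proof -
    have "n \<bullet> (b - M *v x, w \<bullet> x - V) \<le> d" using nF that by (auto simp: F_def)
    then show ?thesis using d by (simp add: yl)
  qed
  have yb: "y \<bullet> b \<le> l * V" using key[of 0] by simp
  \<comment> \<open>Slater's condition enters here: if \<open>l = 0\<close>, the zero plan gives
    \<open>y \<bullet> b \<le> 0\<close>, so \<open>y = 0\<close> by positivity of \<open>b\<close>,
    and the normal vanishes.\<close>
  have "l \<noteq> 0"
  proof
    assume "l = 0"
    then have "(\<Sum>t\<in>UNIV. y $ t * b $ t) \<le> 0" using yb by (simp add: inner_vec_def)
    then have "(\<Sum>t\<in>UNIV. y $ t * b $ t) = 0"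
      using y b by (intro antisym sum_nonneg) (auto simp: less_imp_le)
    then have "y $ t * b $ t = 0" for t
      using y b by (subst (asm) sum_nonneg_eq_0_iff) (auto simp: less_imp_le)
    then have "y = 0" using b by (metis less_irrefl mult_eq_0_iff vec_eq_iff zero_index)
    with n yl \<open>l = 0\<close> show False by (simp add: zero_prod_def)
  qed
  with l have l: "0 < l" by simp
  \<comment> \<open>Along the ray of plans making good \<open>j\<close> alone, \<open>key\<close>
    bounds a linear function of \<open>k\<close>, so its slope is nonpositive.\<close>
  have w: "l * w $ j \<le> (y v* M) $ j" for j
  proof -
    have "(l * w $ j - (y v* M) $ j) * k \<le> l * V - y \<bullet> b" if "0 \<le> k" for k
    proof -
      have "0 \<le> k *\<^sub>R axis j (1::real)" using that by (auto simp: less_eq_vec_def axis_def)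
      from key[OF this] have "y \<bullet> b - (y v* M) \<bullet> (k *\<^sub>R axis j 1) + l * (w \<bullet> (k *\<^sub>R axis j 1) - V) \<le> 0"
        by (simp only: inner_diff_right dot_lmul_matrix)
      then show ?thesis by (simp add: inner_axis algebra_simps)
    qed
    from linear_bounded_above_imp_nonpos[OF this] show ?thesis by simp
  qed
  show ?thesis
  proof (rule that)
    show "0 \<le> (1 / l) *\<^sub>R y" using y l by (simp add: less_eq_vec_def)
    have "((1 / l) *\<^sub>R y) v* M = (1 / l) *\<^sub>R (y v* M)"
      by (simp add: vec_eq_iff vector_matrix_mult_def sum_distrib_left ac_simps)
    then show "w \<le> ((1 / l) *\<^sub>R y) v* M"
      using w l by (simp add: less_eq_vec_def field_simps)
    show "((1 / l) *\<^sub>R y) \<bullet> b \<le> V" using yb l by (simp add: field_simps)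
  qed
qed

text \<open>Every good consumes some resource, and the row of that resource caps its output.\<close>

lemma compact_production_set:
  fixes M :: "real^'g::finite^'q::finite"
  assumes M: "\<And>t j. 0 \<le> M $ t $ j" and col: "\<And>j. \<exists>t. 0 < M $ t $ j"
  shows "compact (production_set M b)"
proof -
  obtain \<tau> where \<tau>: "\<And>j. 0 < M $ \<tau> j $ j" using col by metis
  have "x $ j \<le> b $ \<tau> j / M $ \<tau> j $ j" if x: "x \<in> production_set M b" for x j
  proof -
    have "M $ \<tau> j $ j * x $ j \<le> (\<Sum>i\<in>UNIV. M $ \<tau> j $ i * x $ i)"
      using x M by (intro member_le_sum) (auto simp: production_set_def less_eq_vec_def)
    also have "\<dots> \<le> b $ \<tau> j"
      using x by (auto simp: production_set_def less_eq_vec_def matrix_vector_mult_def)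
    finally show ?thesis using \<tau>[of j] by (simp add: field_simps)
  qed
  then have "production_set M b \<subseteq> cbox 0 (\<chi> j. b $ \<tau> j / M $ \<tau> j $ j)"
    by (auto simp: mem_box_cart production_set_def less_eq_vec_def)
  moreover have "closed (production_set M b)"
    unfolding production_set_def less_eq_vec_def
    by (intro closed_Collect_conj closed_Collect_all closed_Collect_le continuous_intros)
  ultimately show ?thesis
    by (meson bounded_cbox bounded_subset compact_eq_bounded_closed)
qed

section \<open>Coalition values and optimal demand\<close>

definition private_rows :: "real^'g^('q::finite option) \<Rightarrow> real^'g^'q" where
  "private_rows A = (\<chi> t. A $ Some t)"

text \<open>Isolates the pool constraint, the only one in which \<open>z\<close> occurs.\<close>

lemma feasible_plans_iff:
  "x \<in> feasible_plans A B S z \<longleftrightarrow>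
     x \<in> production_set (private_rows A) (coalition_resources B S) \<and> A $ None \<bullet> x \<le> z"
  by (simp add: feasible_plans_def production_set_def private_rows_def append_pool_def
      less_eq_vec_def matrix_vector_mul_component split_option_all conj_ac)

context
  fixes A :: "real^'g::finite^('q::finite option)"
    and B :: "real^'n::finite^'q"
    and p :: "real^'g"
    and r c :: real
  assumes lpp: "lpp_situation A B p r c"
begin

lemma pool_row_nonneg: "0 \<le> A $ None"
  and B_nonneg: "0 \<le> B $ t $ i"
  and c_nonneg: "0 \<le> c" and r_nonneg: "0 \<le> r"
  using lpp by (auto simp: lpp_situation_def less_eq_vec_def)

lemma resource_owned: "\<exists>i. 0 < B $ t $ i"
  using lpp unfolding lpp_situation_def by (elim conjE) (erule spec)

lemma compact_productions: "compact (production_set (private_rows A) b)"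
  using lpp by (intro compact_production_set) (auto simp: lpp_situation_def private_rows_def)

lemma zero_in_productions: "0 \<in> production_set (private_rows A) (coalition_resources B S)"
  using B_nonneg
  by (auto simp: production_set_def coalition_resources_def column_def less_eq_vec_def
      intro!: sum_nonneg)

lemma coalition_value_max:
  assumes "0 \<le> z"
  obtains x where "x \<in> feasible_plans A B S z" "coalition_value A B p c S z = p \<bullet> x - c * z"
    "\<And>x'. x' \<in> feasible_plans A B S z \<Longrightarrow> p \<bullet> x' - c * z \<le> coalition_value A B p c S z"
proof -
  have "feasible_plans A B S z =
      production_set (private_rows A) (coalition_resources B S) \<inter> {x. A $ None \<bullet> x \<le> z}"
    by (auto simp: feasible_plans_iff)
  then have "compact (feasible_plans A B S z)"
    by (simp add: compact_Int_closed compact_productions closed_halfspace_le)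
  moreover have "0 \<in> feasible_plans A B S z"
    using assms zero_in_productions by (simp add: feasible_plans_iff)
  moreover have "continuous_on (feasible_plans A B S z) (\<lambda>x. p \<bullet> x)"
    by (intro continuous_intros)
  ultimately obtain x where x: "x \<in> feasible_plans A B S z"
    and max: "\<forall>x'\<in>feasible_plans A B S z. p \<bullet> x' \<le> p \<bullet> x"
    using continuous_attains_sup[of "feasible_plans A B S z"] by blast
  have "coalition_value A B p c S z = p \<bullet> x - c * z"
    unfolding coalition_value_def
    by (rule Greatest_equality) (use x max in \<open>auto simp: inner_vec_def\<close>)
  with x max show ?thesis by (intro that) auto
qed

text \<open>Paying for the pool amount used instead of the amount \<open>z\<close> acquired never
  costs more, because \<open>c\<close> is nonnegative.\<close>

lemma coalition_value_le_net_profit: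
  assumes "0 \<le> z"
  obtains x where "x \<in> production_set (private_rows A) (coalition_resources B S)"
    "A $ None \<bullet> x \<le> z" "coalition_value A B p c S z \<le> (p - c *\<^sub>R A $ None) \<bullet> x"
proof -
  obtain x where x: "x \<in> feasible_plans A B S z"
    and v: "coalition_value A B p c S z = p \<bullet> x - c * z"
    using coalition_value_max[OF assms] by metis
  have "c * (A $ None \<bullet> x) \<le> c * z"
    using x c_nonneg by (intro mult_left_mono) (auto simp: feasible_plans_iff)
  with x v show ?thesis
    by (intro that[of x]) (auto simp: feasible_plans_iff inner_diff_left)
qed

text \<open>The converse bound: acquiring exactly what \<open>x\<close> uses leaves nothing to pay
  for in vain.\<close>

lemma net_profit_le_coalition_value:
  assumes x: "x \<in> production_set (private_rows A) (coalition_resources B S)"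
  shows "0 \<le> A $ None \<bullet> x"
    and "(p - c *\<^sub>R A $ None) \<bullet> x \<le> coalition_value A B p c S (A $ None \<bullet> x)"
proof -
  show nn: "0 \<le> A $ None \<bullet> x"
    using x pool_row_nonneg by (auto simp: production_set_def intro: inner_nonneg_vec)
  have "x \<in> feasible_plans A B S (A $ None \<bullet> x)" using x by (simp add: feasible_plans_iff)
  then have "p \<bullet> x - c * (A $ None \<bullet> x) \<le> coalition_value A B p c S (A $ None \<bullet> x)"
    using coalition_value_max[OF nn] by metis
  then show "(p - c *\<^sub>R A $ None) \<bullet> x \<le> coalition_value A B p c S (A $ None \<bullet> x)"
    by (simp add: inner_diff_left)
qed

text \<open>
  The optimal demand is the least pool usage among the plans of maximal net profit. This shows that
  the \<open>LEAST\<close> in its definition is attained.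
\<close>

lemma optimal_demand_attained:
  shows "0 \<le> optimal_demand A B p c S"
    and "x \<in> production_set (private_rows A) (coalition_resources B S) \<Longrightarrow>
      (p - c *\<^sub>R A $ None) \<bullet> x \<le> coalition_value A B p c S (optimal_demand A B p c S)"
proof -
  let ?X = "production_set (private_rows A) (coalition_resources B S)"
  let ?w = "p - c *\<^sub>R A $ None"
  let ?v = "coalition_value A B p c S"
  have "continuous_on ?X (\<lambda>x. ?w \<bullet> x)" by (intro continuous_intros)
  then obtain x0 where x0: "x0 \<in> ?X" "\<forall>x\<in>?X. ?w \<bullet> x \<le> ?w \<bullet> x0"
    using continuous_attains_sup[OF compact_productions, of "coalition_resources B S"]
      zero_in_productions by blast
  \<comment> \<open>\<open>K\<close> is the compact face of plans of maximal net profit; the least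
    pool usage \<open>d\<close> on it is the candidate for the optimal demand.\<close>
  define K where "K = ?X \<inter> {x. ?w \<bullet> x = ?w \<bullet> x0}"
  have "compact K" unfolding K_def
    by (intro compact_Int_closed compact_productions closed_hyperplane)
  moreover have "continuous_on K (\<lambda>x. A $ None \<bullet> x)" by (intro continuous_intros)
  moreover have "x0 \<in> K" using x0 by (simp add: K_def)
  ultimately obtain x1 where x1: "x1 \<in> K" "\<forall>x\<in>K. A $ None \<bullet> x1 \<le> A $ None \<bullet> x"
    using continuous_attains_inf[of K] by blast
  define d where "d = A $ None \<bullet> x1"
  have x1X: "x1 \<in> ?X" "?w \<bullet> x1 = ?w \<bullet> x0" using x1 by (auto simp: K_def)
  have le: "?v z \<le> ?w \<bullet> x0" if z: "0 \<le> z" for z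
  proof -
    obtain x where "x \<in> ?X" "?v z \<le> ?w \<bullet> x"
      using coalition_value_le_net_profit[OF z] by metis
    with x0 show ?thesis by fastforce
  qed
  have d0: "0 \<le> d" unfolding d_def by (rule net_profit_le_coalition_value(1)[OF x1X(1)])
  have vd: "?v d = ?w \<bullet> x0"
    using le[OF d0] net_profit_le_coalition_value(2)[OF x1X(1)] x1X(2) unfolding d_def by simp
  have max: "(GREATEST v. v \<in> ?v ` {0..}) = ?w \<bullet> x0"
    by (rule Greatest_equality) (use d0 vd le in \<open>auto intro!: image_eqI[of _ _ d]\<close>)
  \<comment> \<open>An optimal \<open>z\<close> admits a plan that uses at most \<open>z\<close> and
    has maximal net profit; this plan lies in \<open>K\<close>.\<close>
  have least: "d \<le> z" if z: "0 \<le> z" "?v z = ?w \<bullet> x0" for z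
  proof -
    obtain x where x: "x \<in> ?X" "A $ None \<bullet> x \<le> z" "?v z \<le> ?w \<bullet> x"
      using coalition_value_le_net_profit[OF z(1)] by metis
    then have "x \<in> K" using x0 z(2) by (auto simp: K_def intro: antisym)
    with x1 x(2) show ?thesis by (auto simp: d_def intro: order_trans)
  qed
  have "optimal_demand A B p c S = d"
    unfolding optimal_demand_def max
    by (rule Least_equality) (use d0 vd least in auto)
  then show "0 \<le> optimal_demand A B p c S"
    and "x \<in> ?X \<Longrightarrow> ?w \<bullet> x \<le> ?v (optimal_demand A B p c S)"
    using d0 vd x0 by auto
qed

text \<open>Weak duality. The dual constraints do not mention the resources, so one \<open>y\<close>
  bounds all coalitions at once.\<close>

lemma optimistic_game_le_shadow_price:
  assumes y: "0 \<le> y" "p - c *\<^sub>R A $ None \<le> y v* private_rows A"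
  shows "optimistic_game A B p r c S \<le> y \<bullet> coalition_resources B S"
proof (cases "S = {}")
  case True
  then show ?thesis by (simp add: optimistic_game_def coalition_resources_def)
next
  case False
  let ?z = "min (optimal_demand A B p c S) r"
  have "0 \<le> ?z" using optimal_demand_attained(1) r_nonneg by simp
  then obtain x where x: "x \<in> production_set (private_rows A) (coalition_resources B S)"
    and v: "coalition_value A B p c S ?z \<le> (p - c *\<^sub>R A $ None) \<bullet> x"
    using coalition_value_le_net_profit by metis
  note v
  also have "(p - c *\<^sub>R A $ None) \<bullet> x \<le> (y v* private_rows A) \<bullet> x"
    using inner_mono_vec[OF _ y(2), of x] x by (simp add: production_set_def inner_commute)
  also have "\<dots> = y \<bullet> (private_rows A *v x)" by (rule dot_lmul_matrix)
  also have "\<dots> \<le> y \<bullet> coalition_resources B S"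
    using x y(1) by (auto simp: production_set_def intro: inner_mono_vec)
  finally show ?thesis using False by (simp add: optimistic_game_def)
qed

end

section \<open>Core allocation from shadow prices\<close>

theorem theorem18:
  fixes A :: "real^'g::finite^('q::finite option)"
    and B :: "real^'n::finite^'q"
    and p :: "real^'g"
    and r c :: real
  assumes "lpp_situation A B p r c"
    and "optimal_demand A B p c UNIV \<le> r"
  shows "core (optimistic_game A B p r c) \<noteq> {}"
proof -
  let ?v = "optimistic_game A B p r c"
  have vN: "?v UNIV = coalition_value A B p c UNIV (optimal_demand A B p c UNIV)"
    using assms(2) by (simp add: optimistic_game_def)
  have pos: "0 < coalition_resources B UNIV $ t" for t
  proof -
    obtain i where "0 < B $ t $ i" using resource_owned[OF assms(1)] by metis
    then have "0 < (\<Sum>i\<in>UNIV. B $ t $ i)"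
      using sum_pos2[of UNIV i "\<lambda>i. B $ t $ i"] by (simp add: B_nonneg[OF assms(1)])
    then show ?thesis by (simp add: coalition_resources_def column_def)
  qed
  \<comment> \<open>\<open>?v UNIV\<close> is an admissible bound for duality: at its optimal
    demand, which \<open>r\<close> does not cut, the grand coalition earns at least the net profit
    of any plan.\<close>
  obtain y where y: "0 \<le> y" "p - c *\<^sub>R A $ None \<le> y v* private_rows A"
    and yN: "y \<bullet> coalition_resources B UNIV \<le> ?v UNIV"
    using lp_dual_slater[OF pos, of "private_rows A" "p - c *\<^sub>R A $ None" "?v UNIV"]
      optimal_demand_attained(2)[OF assms(1), of _ UNIV] unfolding vN by metis
  define u where "u = (\<chi> i. y \<bullet> column i B)"
  have u: "(\<Sum>i\<in>S. u $ i) = y \<bullet> coalition_resources B S" for S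
    by (simp add: u_def coalition_resources_def inner_sum_right)
  have "?v S \<le> (\<Sum>i\<in>S. u $ i)" for S
    using optimistic_game_le_shadow_price[OF assms(1) y] by (simp add: u)
  \<comment> \<open>Efficiency: the coalition bound for \<open>UNIV\<close> meets the dual bound
    \<open>yN\<close>.\<close>
  moreover from this[of UNIV] have "(\<Sum>i\<in>UNIV. u $ i) = ?v UNIV"
    using yN by (simp add: u)
  ultimately have "u \<in> core ?v" by (simp add: core_def)
  then show ?thesis by blast
qed

end
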